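(* Let $C\subset\mathbb{R}^n$ be a compact convex set, let $F:\mathbb{R}^n\to\mathbb{R}^n$ be continuous and monotone, and let $f:\mathbb{R}^n\to\mathbb{R}$ be a continuous convex function. Consider the problem (r-SMPEC): minimize $f(x)$ subject to $g_D(x)\le0$, $x\in C$. (1) Let $\bar x$ be an optimal solution of (r-SMPEC) and assume that the weak basic constraint qualification $$\partial g_D(\bar x)\cap(-\operatorname{bd}N_C(\bar x))=\emptyset$$ holds at $\bar x$. Then there exist scalars $\beta_i\ge0$ and vectors $y_i\in Y(\bar x)$, $i=1,\dots,n+1$, such that $$-\sum_{i=1}^{n+1}\beta_iF(y_i)\in\partial f(\bar x)+N_C(\bar x).$$ (2) Further, for any $\bar x\in C$, if there exist scalars $\beta_i\ge0$ and vectors $y_i\in Y(\bar x)$, $i=1,\dots,n+1$, such that $$-\sum_{i=1}^{n+1}\beta_iF(y_i)\in\partial f(\bar x)+N_C(\bar x),$$ then $\bar x$ is an optimal solution of (r-SMPEC).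
   Context: $F$ is monotone if $\langle F(y)-F(x),y-x\rangle\ge 0$ for all $x,y\in\mathbb{R}^n$. The variational inequality $VI(F,C)$ is: find $x\in C$ with $\langle F(x),y-x\rangle\ge0$ for all $y\in C$; its solution set $S$ is assumed nonempty. The dual gap function is $g_D(x)=\sup_{y\in C}\langle F(y),x-y\rangle$, a finite convex function on $\mathbb{R}^n$ when $C$ is compact, and $Y(x)=\{y\in C: g_D(x)=\langle F(y),x-y\rangle\}$. The feasible set $\{x\in C: g_D(x)\le0\}$ of (r-SMPEC) equals $S$. $\partial$ denotes the convex subdifferential, $N_C(\bar x)=\{w:\langle w,x-\bar x\rangle\le0\ \forall x\in C\}$ is the normal cone at $\bar x\in C$, and $\operatorname{bd}A$ denotes the (relative) boundary of the set $A$.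
   Formalization: In (2) the point x̄ is additionally assumed feasible, g_D(x̄) ≤ 0 (otherwise false: C=[-1,1], F(y)=y, f=0, x̄=1, β=0), and in (1) bd is the topological boundary in R^n, not the relative boundary, with which (1) fails. *)

theory Defs
  imports "HOL-Analysis.Analysis"
begin

definition monotone_operator :: "('a::real_inner \<Rightarrow> 'a) \<Rightarrow> bool" where
  "monotone_operator F \<longleftrightarrow> (\<forall>x y. (F y - F x) \<bullet> (y - x) \<ge> 0)"

definition VI_solutions :: "('a::real_inner \<Rightarrow> 'a) \<Rightarrow> 'a set \<Rightarrow> 'a set" where
  "VI_solutions F C = {x \<in> C. \<forall>y\<in>C. F x \<bullet> (y - x) \<ge> 0}"

(* Sup is the supremum on the reals, hence only meaningful for a nonempty set that is
   bounded above; this is the case for C compact and nonempty and F continuous. *)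
definition dual_gap :: "('a::real_inner \<Rightarrow> 'a) \<Rightarrow> 'a set \<Rightarrow> 'a \<Rightarrow> real" where
  "dual_gap F C x = (SUP y\<in>C. F y \<bullet> (x - y))"

definition dual_gap_maximizers :: "('a::real_inner \<Rightarrow> 'a) \<Rightarrow> 'a set \<Rightarrow> 'a \<Rightarrow> 'a set" where
  "dual_gap_maximizers F C x = {y \<in> C. dual_gap F C x = F y \<bullet> (x - y)}"

definition subdifferential :: "('a::real_inner \<Rightarrow> real) \<Rightarrow> 'a \<Rightarrow> 'a set" where
  "subdifferential f x = {v. \<forall>y. f y \<ge> f x + v \<bullet> (y - x)}"

(* Only used at points x of C. *)
definition normal_cone :: "'a::real_inner set \<Rightarrow> 'a \<Rightarrow> 'a set" where
  "normal_cone C x = {w. \<forall>y\<in>C. w \<bullet> (y - x) \<le> 0}"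

definition rSMPEC_feasible :: "('a::real_inner \<Rightarrow> 'a) \<Rightarrow> 'a set \<Rightarrow> 'a set" where
  "rSMPEC_feasible F C = {x \<in> C. dual_gap F C x \<le> 0}"

definition rSMPEC_optimal ::
  "('a::real_inner \<Rightarrow> real) \<Rightarrow> ('a \<Rightarrow> 'a) \<Rightarrow> 'a set \<Rightarrow> 'a \<Rightarrow> bool" where
  "rSMPEC_optimal f F C x \<longleftrightarrow> is_arg_min f (\<lambda>z. z \<in> rSMPEC_feasible F C) x"

(* The boundary is the topological one in the whole space. With rel_frontier in place of
   frontier the constraint qualification would hold vacuously whenever the normal cone is a
   linear subspace (in particular at every interior point of C), and the multiplier rule
   fails there: take C = [-1,1], F y = y, f x = x, x = 0.
   The image under uminus is the pointwise negation; unary minus on sets is the complement. *)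
definition weak_BCQ :: "('a::real_inner \<Rightarrow> 'a) \<Rightarrow> 'a set \<Rightarrow> 'a \<Rightarrow> bool" where
  "weak_BCQ F C x \<longleftrightarrow>
     subdifferential (dual_gap F C) x \<inter> uminus ` frontier (normal_cone C x) = {}"

end

theory Submission
  imports Defs
begin

text \<open>
  The argument hinges on the observation that a feasible point is one of its own maximizers. If
  \<open>x \<in> C\<close> and \<open>dual_gap F C x \<le> 0\<close>, then the gap at \<open>x\<close> is exactly \<open>0\<close>, and this value is
  attained at \<open>y = x\<close>; hence \<open>x\<close> lies in \<open>dual_gap_maximizers F C x\<close> and \<open>F x\<close> is a subgradient of
  the dual gap at \<open>x\<close> (\<open>maximizer_imp_subgradient\<close>). On the other hand, \<open>x\<close> solves the dual
  variational inequality, so by Minty's lemma it solves the primal one as well, which says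
  that \<open>- F x\<close> belongs to the normal cone (\<open>feasible_imp_normal\<close>).

  The constraint qualification forbids \<open>- F x\<close> from lying on the frontier of the normal cone, so it
  lies in the interior. A cone absorbs any vector after a large enough multiple of an interior
  point has been added; applied to \<open>- u\<close> for a subgradient \<open>u\<close> of \<open>f\<close>, this gives \<open>t\<close> with
  \<open>- t F x - u\<close> in the normal cone, that is, the multiplier rule with all \<open>y i\<close> equal to \<open>x\<close>.

  The converse is the usual sufficiency of the optimality conditions for convex problems: each
  \<open>F (y i)\<close> is a subgradient of the dual gap, and moving from \<open>x\<close> to another feasible point does
  not increase the dual gap.
\<close>

lemma bdd_above_dual_gap:
  fixes F :: "'a::real_inner \<Rightarrow> 'a"
  assumes "compact C" "continuous_on C F"
  shows "bdd_above ((\<lambda>y. F y \<bullet> (x - y)) ` C)"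
  using assms
  by (intro bounded_imp_bdd_above compact_imp_bounded compact_continuous_image continuous_intros)

lemma dual_gap_upper:
  fixes F :: "'a::real_inner \<Rightarrow> 'a"
  assumes "compact C" "continuous_on C F" "y \<in> C"
  shows "F y \<bullet> (x - y) \<le> dual_gap F C x"
  unfolding dual_gap_def using assms by (intro cSUP_upper bdd_above_dual_gap)

lemma feasible_imp_maximizer:
  fixes F :: "'a::real_inner \<Rightarrow> 'a"
  assumes "compact C" "continuous_on C F" "x \<in> C" "dual_gap F C x \<le> 0"
  shows "x \<in> dual_gap_maximizers F C x"
  using dual_gap_upper[OF assms(1-3), of x] assms(3,4) by (simp add: dual_gap_maximizers_def)

text \<open>
  The dual gap is a supremum of affine functions, and \<open>F y\<close> is the gradient of one that is active
  at \<open>x\<close>.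
\<close>

lemma maximizer_imp_subgradient:
  fixes F :: "'a::real_inner \<Rightarrow> 'a"
  assumes "compact C" "continuous_on C F" "y \<in> dual_gap_maximizers F C x"
  shows "F y \<in> subdifferential (dual_gap F C) x"
proof -
  have "y \<in> C" and gap: "dual_gap F C x = F y \<bullet> (x - y)"
    using assms(3) by (auto simp: dual_gap_maximizers_def)
  have "dual_gap F C x + F y \<bullet> (z - x) \<le> dual_gap F C z" for z
    using dual_gap_upper[OF assms(1,2) \<open>y \<in> C\<close>, of z] by (simp add: gap inner_diff_right)
  then show ?thesis by (simp add: subdifferential_def)
qed

text \<open>
  Minty's lemma: the dual inequality at the points \<open>x + t (y - x)\<close>, divided by \<open>t\<close>, tends to the
  primal inequality as \<open>t\<close> decreases to \<open>0\<close>.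
\<close>

lemma feasible_imp_normal:
  fixes F :: "'a::real_inner \<Rightarrow> 'a"
  assumes "compact C" "convex C" "continuous_on C F" "x \<in> C" "dual_gap F C x \<le> 0"
  shows "- F x \<in> normal_cone C x"
proof -
  have "0 \<le> F x \<bullet> (y - x)" if "y \<in> C" for y
  proof -
    define z where "z t = x + t *\<^sub>R (y - x)" for t :: real
    have zC: "z t \<in> C" if "t \<in> {0..1}" for t
      using convexD_alt[OF assms(2,4) \<open>y \<in> C\<close>, of t] that by (simp add: z_def algebra_simps)
    have cont: "continuous_on {0..1} (\<lambda>t. F (z t) \<bullet> (y - x))"
      by (intro continuous_intros continuous_on_compose2[OF assms(3)])
         (use zC in \<open>auto simp: z_def intro!: continuous_intros\<close>)
    have "0 \<le> F (z t) \<bullet> (y - x)" if "t \<in> {0<..<1}" for t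
    proof -
      have "F (z t) \<bullet> (x - z t) \<le> 0"
        using dual_gap_upper[OF assms(1,3) zC, of t x] assms(5) that by simp
      then have "0 \<le> t * (F (z t) \<bullet> (y - x))" by (simp add: z_def)
      then show ?thesis using that by (simp add: zero_le_mult_iff)
    qed
    moreover have cl: "closure {0<..<1::real} = {0..1}" by simp
    ultimately have "0 \<le> F (z 0) \<bullet> (y - x)"
      by (intro continuous_ge_on_closure[of "{0<..<1::real}" "\<lambda>t. F (z t) \<bullet> (y - x)" 0 0])
         (simp_all add: cl cont del: closure_greaterThanLessThan)
    then show ?thesis by (simp add: z_def)
  qed
  then show ?thesis by (simp add: normal_cone_def)
qed

lemma closed_normal_cone:
  fixes C :: "'a::real_inner set"
  shows "closed (normal_cone C x)"
proof -
  have "normal_cone C x = (\<Inter>y\<in>C. {w. w \<bullet> (y - x) \<le> 0})" by (auto simp: normal_cone_def)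
  then show ?thesis by (auto intro!: closed_INT closed_Collect_le continuous_intros)
qed

lemma normal_cone_scaleR:
  fixes C :: "'a::real_inner set"
  assumes "w \<in> normal_cone C x" "0 \<le> t"
  shows "t *\<^sub>R w \<in> normal_cone C x"
  using assms by (auto simp: normal_cone_def mult_nonneg_nonpos)

text \<open>
  A perturbation \<open>u / t\<close> of the interior point stays in the cone for large \<open>t\<close>; scaling by \<open>t\<close>
  turns it into \<open>u\<close>.
\<close>

lemma interior_normal_cone_absorbs:
  fixes C :: "'a::real_inner set"
  assumes "w \<in> interior (normal_cone C x)"
  obtains t where "0 < t" "t *\<^sub>R w + u \<in> normal_cone C x"
proof -
  obtain e where "0 < e" and e: "ball w e \<subseteq> normal_cone C x"
    using assms by (auto simp: mem_interior)
  define t where "t = (norm u + 1) / e"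
  have "0 < t" using \<open>0 < e\<close> by (simp add: t_def add_nonneg_pos)
  have "norm u / t < e"
    using \<open>0 < e\<close> by (simp add: t_def divide_simps add_nonneg_pos)
  then have "w + (1 / t) *\<^sub>R u \<in> ball w e" using \<open>0 < t\<close> by (simp add: dist_norm)
  then have "t *\<^sub>R (w + (1 / t) *\<^sub>R u) \<in> normal_cone C x"
    using e \<open>0 < t\<close> by (intro normal_cone_scaleR) auto
  then have "t *\<^sub>R w + u \<in> normal_cone C x" using \<open>0 < t\<close> by (simp add: scaleR_add_right)
  with \<open>0 < t\<close> show thesis by (rule that)
qed

text \<open>
  A hyperplane separating \<open>(x, f x)\<close> from the strict epigraph cannot be vertical, because \<open>f\<close> is
  finite everywhere; its slope is a subgradient.
\<close>

lemma convex_imp_subdifferential_nonempty: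
  fixes f :: "'a::euclidean_space \<Rightarrow> real"
  assumes "convex_on UNIV f"
  shows "subdifferential f x \<noteq> {}"
proof -
  define E where "E = {p. f (fst p) < snd p}"
  have "convex E"
  proof (rule convexI)
    fix p q :: "'a \<times> real" and u v :: real
    assume p: "p \<in> E" and q: "q \<in> E" and uv: "0 \<le> u" "0 \<le> v" "u + v = 1"
    have "f (u *\<^sub>R fst p + v *\<^sub>R fst q) \<le> u * f (fst p) + v * f (fst q)"
      using assms uv by (simp add: convex_on_def)
    also have "\<dots> < u * snd p + v * snd q"
      using p q uv by (cases "u = 0") (auto simp: E_def intro!: add_less_le_mono mult_left_mono)
    finally show "u *\<^sub>R p + v *\<^sub>R q \<in> E" by (simp add: E_def)
  qed
  moreover have "(x, f x + 1) \<in> E" "(x, f x) \<notin> E" by (auto simp: E_def)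
  ultimately have "\<exists>n c. n \<noteq> 0 \<and> (\<forall>p\<in>{(x, f x)}. n \<bullet> p \<le> c) \<and> (\<forall>p\<in>E. c \<le> n \<bullet> p)"
    by (intro separating_hyperplane_sets) auto
  then obtain n c where "n \<noteq> 0" and le: "n \<bullet> (x, f x) \<le> c" and ge: "\<forall>p\<in>E. c \<le> n \<bullet> p"
    by blast
  obtain a b where n: "n = (a, b)" by (cases n)
  have sep: "a \<bullet> x + b * f x \<le> a \<bullet> y + b * r" if "f y < r" for y r
    using le ge that by (fastforce simp: n E_def)
  have "0 \<le> b" using sep[of x "f x + 1"] by (simp add: algebra_simps)
  moreover have "b \<noteq> 0"
  proof
    assume "b = 0"
    then have "a \<bullet> x \<le> a \<bullet> (x - a)" using sep[of "x - a" "f (x - a) + 1"] by simp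
    then have "a = 0" using inner_ge_zero[of a] by (simp add: inner_diff_right)
    with \<open>b = 0\<close> \<open>n \<noteq> 0\<close> show False by (simp add: n zero_prod_def)
  qed
  ultimately have "0 < b" by simp
  have "f x + (- (1 / b) *\<^sub>R a) \<bullet> (y - x) \<le> f y" for y
  proof (rule dense_ge)
    fix r assume "f y < r"
    from sep[OF this] \<open>0 < b\<close> show "f x + (- (1 / b) *\<^sub>R a) \<bullet> (y - x) \<le> r"
      by (simp add: field_simps inner_diff_right)
  qed
  then have "- (1 / b) *\<^sub>R a \<in> subdifferential f x" by (simp add: subdifferential_def)
  then show ?thesis by blast
qed

lemma multiplier_rule_necessary:
  fixes F :: "'a::euclidean_space \<Rightarrow> 'a"
  assumes "compact C" "convex C" "continuous_on C F" "convex_on UNIV f"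
    and "x \<in> C" "dual_gap F C x \<le> 0" "weak_BCQ F C x"
  obtains t u w where "0 \<le> t" "x \<in> dual_gap_maximizers F C x"
    "u \<in> subdifferential f x" "w \<in> normal_cone C x" "- (t *\<^sub>R F x) = u + w"
proof -
  have max: "x \<in> dual_gap_maximizers F C x"
    using assms by (intro feasible_imp_maximizer)
  have "- F x \<in> normal_cone C x"
    using assms by (intro feasible_imp_normal)
  moreover have "- F x \<notin> frontier (normal_cone C x)"
    using maximizer_imp_subgradient[OF assms(1,3) max] assms(7) by (force simp: weak_BCQ_def)
  ultimately have int: "- F x \<in> interior (normal_cone C x)"
    using closure_closed[OF closed_normal_cone, of C x] by (simp add: frontier_def)
  obtain u where u: "u \<in> subdifferential f x"
    using convex_imp_subdifferential_nonempty[OF assms(4)] by blast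
  obtain t where "0 < t" "t *\<^sub>R (- F x) + - u \<in> normal_cone C x"
    using interior_normal_cone_absorbs[OF int] .
  then show thesis using max u by (intro that[of t u "t *\<^sub>R (- F x) + - u"]) auto
qed

text \<open>
  Between two feasible points the dual gap stays equal to \<open>0\<close>, so the subgradients \<open>F (y i)\<close> are
  nonpositive in the direction \<open>z - x\<close>; so is a normal vector. Hence the subgradient \<open>v\<close> of \<open>f\<close> is
  nonnegative there.
\<close>

lemma multiplier_rule_sufficient:
  fixes F :: "'a::real_inner \<Rightarrow> 'a"
  assumes "compact C" "continuous_on C F" "x \<in> C" "dual_gap F C x \<le> 0"
    and \<beta>: "\<And>i. i \<in> I \<Longrightarrow> 0 \<le> \<beta> i" and y: "\<And>i. i \<in> I \<Longrightarrow> y i \<in> dual_gap_maximizers F C x"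
    and v: "v \<in> subdifferential f x" and w: "w \<in> normal_cone C x"
    and eq: "- (\<Sum>i\<in>I. \<beta> i *\<^sub>R F (y i)) = v + w"
  shows "rSMPEC_optimal f F C x"
proof -
  have "f x \<le> f z" if "z \<in> rSMPEC_feasible F C" for z
  proof -
    have "z \<in> C" "dual_gap F C z \<le> 0" using that by (auto simp: rSMPEC_feasible_def)
    have "F (y i) \<bullet> (z - x) \<le> 0" if "i \<in> I" for i
    proof -
      have "dual_gap F C x + F (y i) \<bullet> (z - x) \<le> dual_gap F C z"
        using maximizer_imp_subgradient[OF assms(1,2) y[OF that]] by (simp add: subdifferential_def)
      moreover have "0 \<le> dual_gap F C x" using dual_gap_upper[OF assms(1-3), of x] by simp
      ultimately show ?thesis using \<open>dual_gap F C z \<le> 0\<close> by simp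
    qed
    then have "(\<Sum>i\<in>I. \<beta> i *\<^sub>R F (y i)) \<bullet> (z - x) \<le> 0"
      unfolding inner_sum_left using \<beta> by (intro sum_nonpos) (simp add: mult_nonneg_nonpos)
    then have "0 \<le> (v + w) \<bullet> (z - x)" by (simp flip: eq)
    moreover have "w \<bullet> (z - x) \<le> 0" using w \<open>z \<in> C\<close> by (simp add: normal_cone_def)
    ultimately have "0 \<le> v \<bullet> (z - x)" by (simp add: inner_add_left)
    moreover have "f x + v \<bullet> (z - x) \<le> f z" using v by (simp add: subdifferential_def)
    ultimately show ?thesis by simp
  qed
  then show ?thesis
    using assms(3,4) by (auto simp: rSMPEC_optimal_def is_arg_min_linorder rSMPEC_feasible_def)
qed

theorem theorem3p3:
  fixes C :: "(real ^ 'n) set"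
    and F :: "real ^ 'n \<Rightarrow> real ^ 'n"
    and f :: "real ^ 'n \<Rightarrow> real"
  assumes "compact C" and "convex C"
    and "continuous_on UNIV F" and "monotone_operator F"
    and "continuous_on UNIV f" and "convex_on UNIV f"
    and "VI_solutions F C \<noteq> {}"
  shows "(\<forall>xbar. rSMPEC_optimal f F C xbar \<longrightarrow> weak_BCQ F C xbar \<longrightarrow>
            (\<exists>(\<beta> :: nat \<Rightarrow> real) (y :: nat \<Rightarrow> real ^ 'n).
               (\<forall>i\<in>{1..CARD('n) + 1}. \<beta> i \<ge> 0 \<and> y i \<in> dual_gap_maximizers F C xbar) \<and>
               - (\<Sum>i = 1..CARD('n) + 1. \<beta> i *\<^sub>R F (y i))
                 \<in> {v + w | v w. v \<in> subdifferential f xbar \<and> w \<in> normal_cone C xbar}))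
       \<and> (\<forall>xbar\<in>C. dual_gap F C xbar \<le> 0 \<longrightarrow>
            (\<exists>(\<beta> :: nat \<Rightarrow> real) (y :: nat \<Rightarrow> real ^ 'n).
               (\<forall>i\<in>{1..CARD('n) + 1}. \<beta> i \<ge> 0 \<and> y i \<in> dual_gap_maximizers F C xbar) \<and>
               - (\<Sum>i = 1..CARD('n) + 1. \<beta> i *\<^sub>R F (y i))
                 \<in> {v + w | v w. v \<in> subdifferential f xbar \<and> w \<in> normal_cone C xbar})
            \<longrightarrow> rSMPEC_optimal f F C xbar)"
proof (intro conjI allI ballI impI)
  have contC: "continuous_on C F" using assms(3) by (rule continuous_on_subset) simp
  {
    fix xbar assume "rSMPEC_optimal f F C xbar" and bcq: "weak_BCQ F C xbar"
    then have "xbar \<in> C" "dual_gap F C xbar \<le> 0"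
      by (auto simp: rSMPEC_optimal_def is_arg_min_def rSMPEC_feasible_def)
    then obtain t u w where tuw: "0 \<le> t" "xbar \<in> dual_gap_maximizers F C xbar"
        "u \<in> subdifferential f xbar" "w \<in> normal_cone C xbar" "- (t *\<^sub>R F xbar) = u + w"
      using multiplier_rule_necessary[OF assms(1,2) contC assms(6) _ _ bcq] by blast
    \<comment> \<open>A single multiplier suffices; it is placed at the index 1 and the others vanish.\<close>
    define \<beta> :: "nat \<Rightarrow> real" where "\<beta> i = (if i = 1 then t else 0)" for i
    have "(\<Sum>i = 1..CARD('n) + 1. \<beta> i) = t"
      unfolding \<beta>_def by (subst sum.delta) auto
    then have "(\<Sum>i = 1..CARD('n) + 1. \<beta> i *\<^sub>R F xbar) = t *\<^sub>R F xbar"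
      by (simp only: scaleR_sum_left[symmetric])
    then have "- (\<Sum>i = 1..CARD('n) + 1. \<beta> i *\<^sub>R F xbar)
        \<in> {v + w | v w. v \<in> subdifferential f xbar \<and> w \<in> normal_cone C xbar}"
      using tuw by (simp only: mem_Collect_eq) blast
    moreover have "0 \<le> \<beta> i" for i using tuw(1) by (simp add: \<beta>_def)
    ultimately show "\<exists>(\<beta> :: nat \<Rightarrow> real) (y :: nat \<Rightarrow> real ^ 'n).
               (\<forall>i\<in>{1..CARD('n) + 1}. \<beta> i \<ge> 0 \<and> y i \<in> dual_gap_maximizers F C xbar) \<and>
               - (\<Sum>i = 1..CARD('n) + 1. \<beta> i *\<^sub>R F (y i))
                 \<in> {v + w | v w. v \<in> subdifferential f xbar \<and> w \<in> normal_cone C xbar}"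
      using tuw(2) by (intro exI[of _ \<beta>] exI[of _ "\<lambda>_. xbar"] conjI ballI)
  next
    fix xbar
    assume xbar: "xbar \<in> C" "dual_gap F C xbar \<le> 0"
      and "\<exists>(\<beta> :: nat \<Rightarrow> real) (y :: nat \<Rightarrow> real ^ 'n).
               (\<forall>i\<in>{1..CARD('n) + 1}. \<beta> i \<ge> 0 \<and> y i \<in> dual_gap_maximizers F C xbar) \<and>
               - (\<Sum>i = 1..CARD('n) + 1. \<beta> i *\<^sub>R F (y i))
                 \<in> {v + w | v w. v \<in> subdifferential f xbar \<and> w \<in> normal_cone C xbar}"
    then obtain \<beta> :: "nat \<Rightarrow> real" and y v w
      where \<beta>y: "\<forall>i\<in>{1..CARD('n) + 1}. \<beta> i \<ge> 0 \<and> y i \<in> dual_gap_maximizers F C xbar"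
        and vw: "v \<in> subdifferential f xbar" "w \<in> normal_cone C xbar"
        and eq: "- (\<Sum>i = 1..CARD('n) + 1. \<beta> i *\<^sub>R F (y i)) = v + w"
      by (elim exE conjE CollectE)
    show "rSMPEC_optimal f F C xbar"
      by (rule multiplier_rule_sufficient[OF assms(1) contC xbar _ _ vw eq])
         (use \<beta>y in \<open>simp_all only: ball_simps\<close>)
  }
qed

end
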